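(* Let $F:\mathbb{N}\to\mathbb{N}$ be a function and $b\geq 2$ an integer. Then: (1) if $n$ is a base $b$ $F$-Dudeney number, then $F(n)\geq b^{\frac{n-b+1}{b-1}}$; (2) if there is $N\in\mathbb{N}$ such that $n\geq N$ implies $F(n)<b^{\frac{n-b+1}{b-1}}$, then there are finitely many base $b$ $F$-Dudeney numbers.
   Context: For a non-negative integer $x=\sum_{i=0}^{m-1}a_ib^i$ written in base $b$ (digits $0\le a_i\le b-1$), $S_b(x)=\sum_{i=0}^{m-1}a_i$ is its base-$b$ digit sum. A natural number $n$ is a base $b$ $F$-Dudeney number if $n=S_b(F(n))$. *)

theory Defs
  imports Complex_Main
begin

text \<open>The guard \<open>b < 2\<close> only makes the recursion total; the meaning for \<open>b \<ge> 2\<close> is given by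
  \<open>digit_sum_expansion\<close> below.\<close>

function digit_sum :: "nat \<Rightarrow> nat \<Rightarrow> nat" where
  "digit_sum b x = (if x = 0 \<or> b < 2 then 0 else x mod b + digit_sum b (x div b))"
  by auto
termination
  by (relation "measure snd") auto

declare digit_sum.simps [simp del]

lemma digit_sum_0 [simp]: "digit_sum b 0 = 0"
  by (subst digit_sum.simps) simp

lemma digit_sum_step:
  assumes "b \<ge> 2" "a < b"
  shows "digit_sum b (a + b * y) = a + digit_sum b y"
proof (cases "a + b * y = 0")
  case True
  with assms show ?thesis by simp
next
  case False
  with assms show ?thesis
    by (subst digit_sum.simps) simp
qed

lemma digit_sum_expansion:
  fixes b m :: nat and a :: "nat \<Rightarrow> nat"
  assumes "b \<ge> 2" and "\<And>i. i < m \<Longrightarrow> a i \<le> b - 1"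
  shows "digit_sum b (\<Sum>i<m. a i * b ^ i) = (\<Sum>i<m. a i)"
  using assms(2)
proof (induction m arbitrary: a)
  case 0
  show ?case by simp
next
  case (Suc m)
  have "(\<Sum>i<Suc m. a i * b ^ i) = a 0 + b * (\<Sum>i<m. a (Suc i) * b ^ i)"
    by (simp add: sum.lessThan_Suc_shift sum_distrib_left mult_ac del: sum.lessThan_Suc)
  moreover have "a 0 < b"
    using Suc.prems[of 0] assms(1) by simp
  ultimately have "digit_sum b (\<Sum>i<Suc m. a i * b ^ i) = a 0 + (\<Sum>i<m. a (Suc i))"
    using digit_sum_step[OF assms(1)] Suc.IH[of "\<lambda>i. a (Suc i)"] Suc.prems by simp
  then show ?case
    by (simp add: sum.lessThan_Suc_shift del: sum.lessThan_Suc)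
qed

text \<open>Natural numbers are positive here, as opposed to the non-negative integers on which the
  digit sum is defined. Otherwise \<open>n = 0\<close> would be a Dudeney number whenever \<open>F 0 = 0\<close>, although
  then \<open>F 0 < b powr (- 1)\<close>.\<close>

definition dudeney :: "nat \<Rightarrow> (nat \<Rightarrow> nat) \<Rightarrow> nat \<Rightarrow> bool" where
  "dudeney b F n \<longleftrightarrow> n > 0 \<and> n = digit_sum b (F n)"

end

theory Submission
  imports Defs
begin

text \<open>A number with k base-b digits, leading digit nonzero, is at least b^(k-1), while its
  digit sum is at most k(b-1). Eliminating k shows that a positive x with digit sum s satisfies x
  \<ge> b^((s-b+1)/(b-1)); this is \<open>powr_digit_sum_le\<close>, proved by induction on the
  digits so that k never has to be named. For a Dudeney number n, taking x = F(n) gives s = n and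
  hence the lower bound. If F stays strictly below that bound from N on, every Dudeney number is
  less than N.\<close>

lemma powr_digit_sum_le:
  fixes b x :: nat
  assumes "b \<ge> 2" "x > 0"
  shows "real b powr ((real (digit_sum b x) - real b + 1) / (real b - 1)) \<le> real x"
  using assms(2)
proof (induction x rule: less_induct)
  case (less x)
  have b: "real b > 1" using assms(1) by simp
  define a y where "a = x mod b" and "y = x div b"
  have a: "a < b" and x: "x = a + b * y"
    using assms(1) by (simp_all add: a_def y_def)
  have S: "digit_sum b x = a + digit_sum b y"
    unfolding x by (rule digit_sum_step[OF assms(1) a])
  have a': "real a \<le> real b - 1" using a by simp
  show ?case
  proof (cases "y = 0")
    case True
    \<comment> \<open>With a single digit, the digit sum is at most b-1, so the exponent is not
      positive and the power is at most 1.\<close>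
    then have "(real (digit_sum b x) - real b + 1) / (real b - 1) \<le> 0"
      using S a' b by (simp add: divide_nonpos_pos)
    then have "real b powr ((real (digit_sum b x) - real b + 1) / (real b - 1)) \<le> real b powr 0"
      using b by (intro powr_mono) auto
    also have "\<dots> \<le> real x" using b less.prems by simp
    finally show ?thesis .
  next
    case False
    have "y < x" using assms(1) less.prems by (simp add: y_def)
    \<comment> \<open>The last digit adds a/(b-1) \<le> 1 to the exponent, so it multiplies the
      power by at most b; this is matched by x \<ge> b * y.\<close>
    have "(real (digit_sum b x) - real b + 1) / (real b - 1)
        \<le> ((real b - 1) + (real (digit_sum b y) - real b + 1)) / (real b - 1)"
      using S a' b by (intro divide_right_mono) auto
    also have "\<dots> = 1 + (real (digit_sum b y) - real b + 1) / (real b - 1)"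
      using b by (subst add_divide_distrib) simp
    finally have "real b powr ((real (digit_sum b x) - real b + 1) / (real b - 1))
        \<le> real b powr (1 + (real (digit_sum b y) - real b + 1) / (real b - 1))"
      using b by (intro powr_mono) auto
    also have "\<dots> = real b * real b powr ((real (digit_sum b y) - real b + 1) / (real b - 1))"
      using b by (simp add: powr_add)
    also have "\<dots> \<le> real b * real y"
      using less.IH[OF \<open>y < x\<close>] False by (intro mult_left_mono) auto
    also have "\<dots> \<le> real x" by (simp add: x)
    finally show ?thesis .
  qed
qed

theorem theorem5p2:
  fixes F :: "nat \<Rightarrow> nat" and b :: nat
  assumes "b \<ge> 2"
  shows "(\<forall>n. dudeney b F n \<longrightarrow>
            real (F n) \<ge> real b powr ((real n - real b + 1) / (real b - 1))) \<and>
         ((\<exists>N::nat. \<forall>n\<ge>N. real (F n) < real b powr ((real n - real b + 1) / (real b - 1))) \<longrightarrow>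
            finite {n. dudeney b F n})"
proof (intro conjI impI)
  show bound: "\<forall>n. dudeney b F n \<longrightarrow>
      real (F n) \<ge> real b powr ((real n - real b + 1) / (real b - 1))"
  proof (intro allI impI)
    fix n
    assume "dudeney b F n"
    then have "n > 0" and n: "digit_sum b (F n) = n"
      by (simp_all add: dudeney_def)
    \<comment> \<open>Positivity of n enters here: F(n) = 0 would have digit sum 0, and
      \<open>powr_digit_sum_le\<close> covers only positive arguments.\<close>
    then have "F n > 0" by (metis digit_sum_0 gr0I)
    from powr_digit_sum_le[OF assms this]
    show "real (F n) \<ge> real b powr ((real n - real b + 1) / (real b - 1))"
      by (simp add: n)
  qed
  assume "\<exists>N::nat. \<forall>n\<ge>N. real (F n) < real b powr ((real n - real b + 1) / (real b - 1))"
  then obtain N :: nat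
    where N: "\<forall>n\<ge>N. real (F n) < real b powr ((real n - real b + 1) / (real b - 1))" ..
  \<comment> \<open>A Dudeney number n \<ge> N would violate \<open>bound\<close>, whose inequality
    is the exact negation of the one in \<open>N\<close>.\<close>
  have "{n. dudeney b F n} \<subseteq> {..<N}"
    using bound N by (force simp: not_less[symmetric])
  then show "finite {n. dudeney b F n}"
    by (rule finite_subset) simp
qed

end
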